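(* Let $\mathcal{G}$ be a class of graphs closed under taking subgraphs such that every graph in $\mathcal{G}$ is $H$-minor-free for some fixed graph $H$. Then $\mathrm{pcol}_\star(\mathcal{G})=p(\mathcal{G})$.
   Context: All graphs are finite and simple. A $t$-island in $G$ is a non-empty $S\subseteq V(G)$ such that every vertex of $S$ has fewer than $t$ neighbors in $V(G)\setminus S$. $t$-percolation: starting with a set $A_0\subseteq V(G)$ of active vertices, repeatedly make active any inactive vertex with at least $t$ active neighbors, until no such vertex exists; $A_0$ $t$-percolates if at the end all vertices are active. For $\varepsilon>0$, $G$ is $\varepsilon$-resistant to $t$-percolation if no set of at most $\varepsilon|V(G)|$ vertices of $G$ $t$-percolates. The percolation threshold $p(\mathcal{G})$ is the minimum integer $t$ such that for some $\varepsilon>0$ all graphs in $\mathcal{G}$ with at least one vertex are $\varepsilon$-resistant to $t$-percolation ($\infty$ if none). The pervasive clustered coloring number $\mathrm{pcol}_\star(\mathcal{G})$ is the minimum integer $t$ such that for some $\varepsilon>0$ every $G\in\mathcal{G}$ contains at least $\varepsilon|V(G)|$ pairwise disjoint $t$-islands ($\infty$ if none). *)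

theory Defs
  imports
    Complex_Main
    "HOL-Library.Disjoint_Sets"
    "HOL-Library.Extended_Nat"
    "Graph_Theory.Graph_Theory"
begin

text \<open>
  Finite simple graphs are values of type \<open>'a pair_pre_digraph\<close> satisfying \<open>pair_graph\<close>
  (finite, loopless, symmetric arc relation; the null graph is allowed): an edge \<open>uv\<close> is the
  pair of arcs \<open>(u, v)\<close>, \<open>(v, u)\<close>.  A class of graphs is a set of such values over an
  arbitrary vertex type.  It is not required to be closed under isomorphism.
\<close>

definition nbrs :: "'a pair_pre_digraph \<Rightarrow> 'a \<Rightarrow> 'a set" where
  "nbrs G v = {u. (v, u) \<in> parcs G}"

definition subgraph_closed :: "'a pair_pre_digraph set \<Rightarrow> bool" where
  "subgraph_closed \<G> \<longleftrightarrow>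
     (\<forall>G\<in>\<G>. \<forall>K. pair_graph K \<and> subgraph (with_proj K) (with_proj G) \<longrightarrow> K \<in> \<G>)"

text \<open>
  Minors via branch sets: \<open>H\<close> arises from a subgraph of \<open>G\<close> by contracting each \<open>B v\<close> to the
  vertex \<open>v\<close>.  Branch sets are non-empty because \<open>connected\<close> excludes the null graph.
\<close>

definition is_minor :: "'b pair_pre_digraph \<Rightarrow> 'a pair_pre_digraph \<Rightarrow> bool" where
  "is_minor H G \<longleftrightarrow>
     (\<exists>B :: 'b \<Rightarrow> 'a set.
        (\<forall>v\<in>pverts H. B v \<subseteq> pverts G \<and> Digraph_Component.connected (with_proj G \<restriction> B v)) \<and>
        disjoint_family_on B (pverts H) \<and>
        (\<forall>(u, v)\<in>parcs H. \<exists>x\<in>B u. \<exists>y\<in>B v. (x, y) \<in> parcs G))"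

definition minor_free :: "'b pair_pre_digraph \<Rightarrow> 'a pair_pre_digraph \<Rightarrow> bool" where
  "minor_free H G \<longleftrightarrow> \<not> is_minor H G"

definition is_island :: "nat \<Rightarrow> 'a pair_pre_digraph \<Rightarrow> 'a set \<Rightarrow> bool" where
  "is_island t G S \<longleftrightarrow>
     S \<noteq> {} \<and> S \<subseteq> pverts G \<and> (\<forall>v\<in>S. card (nbrs G v \<inter> (pverts G - S)) < t)"

text \<open>One activation.  The final active set does not depend on the order of the activations.\<close>

inductive activation :: "nat \<Rightarrow> 'a pair_pre_digraph \<Rightarrow> 'a set \<Rightarrow> 'a set \<Rightarrow> bool"
  for t G where
  "v \<in> pverts G - A \<Longrightarrow> t \<le> card (nbrs G v \<inter> A) \<Longrightarrow> activation t G A (insert v A)"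

definition percolates :: "nat \<Rightarrow> 'a pair_pre_digraph \<Rightarrow> 'a set \<Rightarrow> bool" where
  "percolates t G A \<longleftrightarrow> A \<subseteq> pverts G \<and> (activation t G)\<^sup>*\<^sup>* A (pverts G)"

definition resistant :: "real \<Rightarrow> nat \<Rightarrow> 'a pair_pre_digraph \<Rightarrow> bool" where
  "resistant \<epsilon> t G \<longleftrightarrow>
     (\<forall>A\<subseteq>pverts G. real (card A) \<le> \<epsilon> * real (card (pverts G)) \<longrightarrow> \<not> percolates t G A)"

text \<open>
  Both parameters are infima in \<^typ>\<open>enat\<close>: the infimum of a non-empty set is its minimum and
  the infimum of the empty set is \<open>\<infinity>\<close>.
\<close>

definition percolation_threshold :: "'a pair_pre_digraph set \<Rightarrow> enat" where
  "percolation_threshold \<G> =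
     Inf {enat t | t. \<exists>\<epsilon>>0. \<forall>G\<in>\<G>. pverts G \<noteq> {} \<longrightarrow> resistant \<epsilon> t G}"

definition pcol_star :: "'a pair_pre_digraph set \<Rightarrow> enat" where
  "pcol_star \<G> =
     Inf {enat t | t. \<exists>\<epsilon>>0. \<forall>G\<in>\<G>. \<exists>\<I>.
            (\<forall>S\<in>\<I>. is_island t G S) \<and> pairwise disjnt \<I> \<and>
            real (card \<I>) \<ge> \<epsilon> * real (card (pverts G))}"

end

theory Submission
  imports Defs
begin

text \<open>
  A percolating set meets every \<open>t\<close>-island, so many disjoint islands give resistance.
  Conversely, an \<open>H\<close>-minor-free graph on \<open>n\<close> vertices has a set \<open>X\<close> of at most \<open>\<epsilon>n/2\<close> vertices
  whose deletion leaves components of size at most a constant \<open>M\<close>.  Start the percolation from \<open>X\<close>.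
  In each component of \<open>G - X\<close> the set of vertices that stay inactive is empty or an island, and
  activating all these vertices as well would give a percolating set.  By resistance they number
  at least \<open>\<epsilon>n/2\<close>, so at least \<open>\<epsilon>n/(2M)\<close> components contain an island.

  The set \<open>X\<close> comes from iterating the separator theorem of Alon, Seymour and Thomas with
  separators of size \<open>O(\<surd>n)\<close>, until all components are small.  For the separator theorem, suppose
  that every small set leaves a component with more than half of the vertices.  Consider a clique
  model and a small subset \<open>X\<close> of its union, and let \<open>B\<close> be the large component of \<open>G - X\<close>, disjoint
  from the model.  Either some branch set is not adjacent to \<open>B\<close> and can be dropped, or a small
  connected subset of \<open>B\<close> touches all branch sets and can be added to the model, or a small set \<open>Z\<close>
  separates \<open>B\<close> from a branch set, which can then absorb part of \<open>Z\<close>.  Each of these moves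
  decreases \<open>2|B|\<close> plus the number of branch sets.
\<close>

section \<open>Connected sets\<close>

text \<open>Connectedness without paths: no non-empty proper subset of \<open>T\<close> is closed
  under the edges inside \<open>T\<close>. For symmetric \<open>E\<close> this is the usual
  connectedness of the subgraph induced on \<open>T\<close>.\<close>

definition linked :: "('a \<times> 'a) set \<Rightarrow> 'a set \<Rightarrow> bool" where
  "linked E T \<longleftrightarrow> T \<noteq> {} \<and>
     (\<forall>S\<subseteq>T. S \<noteq> {} \<longrightarrow> (\<forall>x\<in>S. \<forall>y\<in>T. (x, y) \<in> E \<longrightarrow> y \<in> S) \<longrightarrow> S = T)"

lemma linked_nonempty: "linked E T \<Longrightarrow> T \<noteq> {}"
  by (simp add: linked_def)

text \<open>\<open>T \<inter> S\<close> is non-empty and closed inside \<open>T\<close>, hence all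
  of \<open>T\<close>. Connectedness is used below mainly in this form.\<close>

lemma linked_subset:
  assumes "linked E T" "T \<inter> S \<noteq> {}"
    and "\<And>x y. x \<in> T \<Longrightarrow> x \<in> S \<Longrightarrow> y \<in> T \<Longrightarrow> (x, y) \<in> E \<Longrightarrow> y \<in> S"
  shows "T \<subseteq> S"
proof -
  have "T \<inter> S = T"
    using assms(1)[unfolded linked_def, THEN conjunct2, rule_format, of "T \<inter> S"] assms(2,3) by blast
  then show ?thesis by blast
qed

lemma linked_singleton: "linked E {v}"
  by (auto simp: linked_def)

lemma linked_insert:
  assumes "sym E" "linked E T" "v \<in> T" "(v, u) \<in> E"
  shows "linked E (insert u T)"
  unfolding linked_def
proof (intro conjI allI impI)
  fix S
  assume S: "S \<subseteq> insert u T" "S \<noteq> {}"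
    and cl: "\<forall>x\<in>S. \<forall>y\<in>insert u T. (x, y) \<in> E \<longrightarrow> y \<in> S"
  have "T \<inter> S \<noteq> {}"
  proof (cases "u \<in> S")
    case True
    then have "v \<in> S" using cl assms(3) symD[OF assms(1,4)] by blast
    then show ?thesis using assms by blast
  qed (use S in blast)
  then have "T \<subseteq> S"
    using linked_subset[OF assms(2)] cl by blast
  moreover have "u \<in> S" using calculation cl assms by blast
  ultimately show "S = insert u T" using S by blast
qed simp

section \<open>Components of an induced subgraph\<close>

inductive_set component :: "('a \<times> 'a) set \<Rightarrow> 'a set \<Rightarrow> 'a \<Rightarrow> 'a set"
  for E S v where
  base: "v \<in> S \<Longrightarrow> v \<in> component E S v"
| step: "u \<in> component E S v \<Longrightarrow> (u, w) \<in> E \<Longrightarrow> w \<in> S \<Longrightarrow> w \<in> component E S v"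

lemma component_subset: "component E S v \<subseteq> S"
proof
  show "u \<in> S" if "u \<in> component E S v" for u
    using that by cases auto
qed

lemma linked_component:
  assumes "sym E" "v \<in> S"
  shows "linked E (component E S v)"
  unfolding linked_def
proof (intro conjI allI impI)
  show "component E S v \<noteq> {}"
    using assms component.base[of v S E] by blast
  fix P
  assume P: "P \<subseteq> component E S v" "P \<noteq> {}"
    and cl: "\<forall>x\<in>P. \<forall>y\<in>component E S v. (x, y) \<in> E \<longrightarrow> y \<in> P"
  have "u \<in> P \<longrightarrow> v \<in> P" if "u \<in> component E S v" for u
    using that
  proof induction
    case (step u w)
    then have "w \<in> P \<Longrightarrow> u \<in> P" using cl symD[OF assms(1) step(2)] by blast
    then show ?case using step by blast
  qed simp
  then have v: "v \<in> P" using P by blast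
  have "u \<in> P" if "u \<in> component E S v" for u
    using that
  proof induction
    case (step u w)
    then show ?case using cl component.step by metis
  qed (use v in simp)
  then show "P = component E S v" using P by blast
qed

lemma linked_subset_component:
  assumes "linked E T" "T \<subseteq> S" "v \<in> T"
  shows "T \<subseteq> component E S v"
proof (rule linked_subset[OF assms(1)])
  show "T \<inter> component E S v \<noteq> {}"
    using assms component.base[of v S E] by blast
  show "y \<in> component E S v" if "x \<in> component E S v" "y \<in> T" "(x, y) \<in> E" for x y
    using component.step[OF that(1,3)] that(2) assms(2) by blast
qed

lemma component_eqI:
  assumes "sym E" "u \<in> component E S v"
  shows "component E S u = component E S v"
proof -
  have uS: "u \<in> S" using assms(2) component_subset[of E S v] by blast
  have vS: "v \<in> S" using assms(2) by induction
  have 1: "component E S v \<subseteq> component E S u"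
    using linked_subset_component[OF linked_component[OF assms(1) vS] component_subset assms(2)] .
  then have "v \<in> component E S u" using component.base[OF vS] by blast
  then have "component E S u \<subseteq> component E S v"
    using linked_subset_component[OF linked_component[OF assms(1) uS] component_subset] by blast
  with 1 show ?thesis by blast
qed

lemma disjnt_components:
  assumes "sym E"
  shows "pairwise disjnt (component E S ` S)"
proof (rule pairwiseI)
  fix K L assume "K \<in> component E S ` S" "L \<in> component E S ` S" "K \<noteq> L"
  then show "disjnt K L"
    unfolding disjnt_iff using component_eqI[OF assms] by (metis imageE)
qed

section \<open>Balanced separators\<close>

text \<open>
  Alon, Seymour and Thomas: pairs \<open>(S, v)\<close> are layered by the least size of a connected set
  containing \<open>v\<close> and meeting \<open>A i\<close> for every \<open>i \<in> S\<close>.  If no small connected set meets all the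
  \<open>A i\<close>, the sparsest of the first \<open>r\<close> layers projects to the separator \<open>Z\<close>.
\<close>

lemma small_linked_or_separator:
  fixes A :: "'i \<Rightarrow> 'a set"
  assumes "sym E" "finite B" "finite I" "r \<ge> 1"
  shows "(\<exists>T\<subseteq>B. linked E T \<and> card T \<le> r \<and> (\<forall>i\<in>I. T \<inter> A i \<noteq> {})) \<or>
         (\<exists>Z\<subseteq>B. card Z * r \<le> 2 ^ card I * card B \<and>
            (\<forall>U\<subseteq>B - Z. linked E U \<longrightarrow> (\<exists>i\<in>I. U \<inter> A i = {})))"
proof -
  \<comment> \<open>Layer \<open>j\<close> allows \<open>Suc j\<close> vertices, so singletons fit
    into layer 0 and a set found in a layer \<open>j < r\<close> has at most \<open>r\<close>
    vertices.\<close>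
  define R where "R j = {(S, v). S \<subseteq> I \<and> (\<exists>T\<subseteq>B. linked E T \<and> v \<in> T \<and> card T \<le> Suc j \<and>
    (\<forall>i\<in>S. T \<inter> A i \<noteq> {}))}" for j
  have Rsub: "R j \<subseteq> Pow I \<times> B" for j unfolding R_def by auto
  have fin: "finite (Pow I \<times> B)" using assms by simp
  have finR: "finite (R j)" for j using Rsub fin finite_subset by metis
  have Riff: "(S, v) \<in> R j \<longleftrightarrow> S \<subseteq> I \<and> (\<exists>T\<subseteq>B. linked E T \<and> v \<in> T \<and> card T \<le> Suc j \<and>
    (\<forall>i\<in>S. T \<inter> A i \<noteq> {}))" for S v j
    unfolding R_def by simp
  have mono: "R j \<subseteq> R (Suc j)" for j
    unfolding subset_iff split_paired_All Riff by (meson le_SucI)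
  define N where "N = card (Pow I \<times> B)"
  have N: "N = 2 ^ card I * card B"
    unfolding N_def using assms by (simp add: card_cartesian_product card_Pow)
  have tele: "(\<Sum>j<k. card (R (Suc j) - R j)) \<le> card (R k)" for k
  proof (induction k)
    case (Suc k)
    have "card (R (Suc k)) = card (R k) + card (R (Suc k) - R k)"
      using mono[of k] finR
      by (simp add: card_Diff_subset card_mono)
    with Suc show ?case by simp
  qed simp
  \<comment> \<open>The increments of the nested layers sum to at most \<open>N\<close>, so one of
    the first \<open>r\<close> has at most \<open>N / r\<close> elements.\<close>
  have "\<exists>j<r. card (R (Suc j) - R j) * r \<le> N"
  proof (rule ccontr)
    assume "\<not> ?thesis"
    then have "(\<Sum>j<r. Suc N) \<le> (\<Sum>j<r. card (R (Suc j) - R j) * r)"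
      by (intro sum_mono) (auto simp: not_le)
    also have "\<dots> = (\<Sum>j<r. card (R (Suc j) - R j)) * r" by (simp add: sum_distrib_right)
    also have "\<dots> \<le> N * r"
      using tele[of r] card_mono[OF fin Rsub[of r]] unfolding N_def by (intro mult_right_mono) auto
    finally show False using assms by (simp add: mult.commute)
  qed
  then obtain j where j: "j < r" "card (R (Suc j) - R j) * r \<le> N" by blast
  show ?thesis
  proof (cases "\<exists>v. (I, v) \<in> R j")
    case True
    then obtain T where "T \<subseteq> B" "linked E T" "card T \<le> Suc j" "\<forall>i\<in>I. T \<inter> A i \<noteq> {}"
      unfolding Riff by blast
    then show ?thesis using j by (intro disjI1) (meson Suc_leI le_trans)
  next
    case False
    define Z where "Z = snd ` (R (Suc j) - R j)"
    have ZB: "Z \<subseteq> B" unfolding Z_def using Rsub by fastforce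
    have "card Z \<le> card (R (Suc j) - R j)" unfolding Z_def using finR by (intro card_image_le) simp
    then have cZ: "card Z * r \<le> 2 ^ card I * card B"
      using j(2) N by (metis le_trans mult_le_mono1)
    have "\<exists>i\<in>I. U \<inter> A i = {}" if U: "U \<subseteq> B - Z" "linked E U" for U
    proof (rule ccontr)
      assume neg: "\<not> ?thesis"
      have "\<forall>u\<in>U. (S, u) \<in> R j" if "finite S" "S \<subseteq> I" for S
        using that
      proof induction
        case empty
        show ?case
        proof
          fix u assume "u \<in> U"
          then show "({}, u) \<in> R j"
            unfolding Riff using \<open>u \<in> U\<close> U
            by (intro conjI exI[of _ "{u}"]) (auto simp: linked_singleton)
        qed
      next
        case (insert i S)
        obtain a where a: "a \<in> U" "a \<in> A i" using neg insert by blast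
        \<comment> \<open>Membership spreads through \<open>U\<close> from a vertex of
          \<open>A i\<close>: extending \<open>T\<close> along an edge costs one vertex and lands in
          layer \<open>Suc j\<close>, but a vertex outside \<open>Z\<close> gains no pair between
          the two layers.\<close>
        have "U \<subseteq> {u. (insert i S, u) \<in> R j}"
        proof (rule linked_subset[OF U(2)])
          have "(S, a) \<in> R j" using insert a by blast
          then have "(insert i S, a) \<in> R j" using insert(4) a unfolding Riff by blast
          then show "U \<inter> {u. (insert i S, u) \<in> R j} \<noteq> {}" using a by blast
        next
          fix x y
          assume xy: "x \<in> U" "x \<in> {u. (insert i S, u) \<in> R j}" "y \<in> U" "(x, y) \<in> E"
          then obtain T where T: "T \<subseteq> B" "linked E T" "x \<in> T" "card T \<le> Suc j"
            "\<forall>i\<in>insert i S. T \<inter> A i \<noteq> {}" unfolding Riff by blast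
          have "card (Set.insert y T) \<le> Suc (Suc j)"
            using T(4) finite_subset[OF T(1) assms(2)] by (simp add: card_insert_if)
          moreover have "Set.insert y T \<subseteq> B" using T U xy by blast
          moreover have "linked E (Set.insert y T)" using linked_insert assms(1) T xy by metis
          ultimately have "(insert i S, y) \<in> R (Suc j)"
            unfolding Riff using T(5) insert(4)
            by (intro conjI exI[of _ "Set.insert y T"]) auto
          moreover have "y \<notin> Z" using xy U by blast
          ultimately show "y \<in> {u. (insert i S, u) \<in> R j}"
            unfolding Z_def by (metis (no_types, lifting) DiffI imageI mem_Collect_eq snd_conv)
        qed
        then show ?case by blast
      qed
      from this[OF assms(3) subset_refl] show False
        using False linked_nonempty[OF U(2)] by blast
    qed
    then show ?thesis using ZB cZ by blast
  qed
qed

section \<open>Clique models and the descent to ever smaller large components\<close>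

text \<open>A model of a complete graph as a minor. Its vertices are interchangeable, so the branch
  sets form an unindexed set.\<close>

definition clique_model :: "('a \<times> 'a) set \<Rightarrow> 'a set set \<Rightarrow> bool" where
  "clique_model E \<C> \<longleftrightarrow> (\<forall>C\<in>\<C>. linked E C) \<and> pairwise disjnt \<C> \<and>
     (\<forall>C\<in>\<C>. \<forall>D\<in>\<C>. C \<noteq> D \<longrightarrow> (\<exists>x\<in>C. \<exists>y\<in>D. (x, y) \<in> E))"

lemma clique_model_subset: "clique_model E \<C> \<Longrightarrow> \<D> \<subseteq> \<C> \<Longrightarrow> clique_model E \<D>"
  unfolding clique_model_def by (meson pairwise_subset subset_iff)

lemma clique_model_insert:
  assumes "sym E" "clique_model E \<C>" "linked E T"
    and "\<And>C. C \<in> \<C> \<Longrightarrow> disjnt T C"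
    and "\<And>C. C \<in> \<C> \<Longrightarrow> \<exists>x\<in>C. \<exists>y\<in>T. (x, y) \<in> E"
  shows "clique_model E (insert T \<C>)"
proof -
  have "\<exists>x\<in>T. \<exists>y\<in>C. (x, y) \<in> E" if "C \<in> \<C>" for C
    using assms(5)[OF that] assms(1) by (meson symD)
  then show ?thesis
    using assms unfolding clique_model_def by (auto simp: pairwise_insert disjnt_sym)
qed

text \<open>The budget is \<open>q\<close> vertices per branch set. With \<open>r = q\<close> the
  layer argument gives \<open>card Z * q \<le> 2 ^ h * card V \<le> q * q\<close>, so
  \<open>Z\<close> fits into the budget of one branch set; as the model has fewer than
  \<open>h\<close> of them, the separators stay within \<open>h * q\<close>.\<close>

theorem balanced_separator:
  assumes symE: "sym E" and finV: "finite V"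
    and no_model: "\<And>\<C>. clique_model E \<C> \<Longrightarrow> \<Union>\<C> \<subseteq> V \<Longrightarrow> finite \<C> \<Longrightarrow> card \<C> \<noteq> h"
    and q: "q \<ge> 1" "2 ^ h * card V \<le> q * q"
  shows "\<exists>X\<subseteq>V. card X \<le> h * q \<and> (\<forall>U\<subseteq>V - X. linked E U \<longrightarrow> 2 * card U \<le> card V)"
proof (rule ccontr)
  assume no_sep: "\<not> ?thesis"
  \<comment> \<open>\<open>B\<close> is the component of \<open>V - X\<close> with more than half of
    the vertices; the last conjunct says that edges within \<open>V\<close> leave \<open>B\<close>
    only into \<open>X\<close>.\<close>
  define big where "big X B \<longleftrightarrow> B \<subseteq> V - X \<and> linked E B \<and> card V < 2 * card B \<and>
    (\<forall>x\<in>B. \<forall>y\<in>V. (x, y) \<in> E \<longrightarrow> y \<in> B \<union> X)" for X B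
  have ex_big: "\<exists>B. big X B" if X: "X \<subseteq> V" "card X \<le> h * q" for X
  proof -
    obtain U where U: "U \<subseteq> V - X" "linked E U" "card V < 2 * card U"
      using no_sep X by (meson not_le)
    obtain u where u: "u \<in> U" using linked_nonempty[OF U(2)] by blast
    let ?B = "component E (V - X) u"
    have sub: "?B \<subseteq> V - X" by (rule component_subset)
    have "U \<subseteq> ?B" using linked_subset_component[OF U(2,1) u] .
    then have "card U \<le> card ?B"
      using sub finV by (intro card_mono) (auto intro: finite_subset)
    moreover have "linked E ?B" using linked_component[OF symE] u U by blast
    moreover have "y \<in> ?B \<union> X" if "x \<in> ?B" "y \<in> V" "(x, y) \<in> E" for x y
      using component.step[OF that(1,3)] that(2) by blast
    ultimately have "big X ?B" unfolding big_def using sub U(3) by auto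
    then show ?thesis by blast
  qed
  have big_meet: "B \<inter> B' \<noteq> {}" if "big X B" "big X' B'" for X X' B B'
  proof
    assume "B \<inter> B' = {}"
    moreover have BV: "B \<union> B' \<subseteq> V"
      using that unfolding big_def by blast
    moreover have "finite B" "finite B'"
      using finite_subset[OF BV finV] by simp_all
    ultimately have "card B + card B' \<le> card V"
      using card_mono[OF finV, of "B \<union> B'"] by (simp add: card_Un_disjoint)
    then show False using that unfolding big_def by linarith
  qed
  \<comment> \<open>The state of the descent. Bounding \<open>X\<close> on each branch set, not only
    in total, keeps the budget when a branch set is dropped or replaced.\<close>
  define P where "P \<C> X B \<longleftrightarrow> finite \<C> \<and> card \<C> < h \<and> clique_model E \<C> \<and> \<Union>\<C> \<subseteq> V \<and>
    X \<subseteq> \<Union>\<C> \<and> (\<forall>C\<in>\<C>. card (X \<inter> C) \<le> q) \<and> big X B \<and> B \<inter> \<Union>\<C> = {}" for \<C> X B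
  have card_X: "card X \<le> card \<C> * q"
    if "finite \<C>" "X \<subseteq> \<Union>\<C>" "\<forall>C\<in>\<C>. card (X \<inter> C) \<le> q" for \<C> X
  proof -
    have "X = (\<Union>C\<in>\<C>. X \<inter> C)" using that by blast
    then have "card X \<le> (\<Sum>C\<in>\<C>. card (X \<inter> C))"
      using card_UN_le[OF that(1), of "\<lambda>C. X \<inter> C"] by simp
    also have "\<dots> \<le> card \<C> * q"
      using sum_bounded_above[of \<C> "\<lambda>C. card (X \<inter> C)" q] that(3) by simp
    finally show ?thesis .
  qed
  have descent: "\<exists>\<C>' X' B'. P \<C>' X' B' \<and> 2 * card B' + card \<C>' < 2 * card B + card \<C>"
    if P: "P \<C> X B" for \<C> X B
  proof -
    have fC: "finite \<C>" and ch: "card \<C> < h" and model: "clique_model E \<C>" and CV: "\<Union>\<C> \<subseteq> V"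
      and XC: "X \<subseteq> \<Union>\<C>" and Xq: "\<And>C. C \<in> \<C> \<Longrightarrow> card (X \<inter> C) \<le> q" and bigB: "big X B"
      and disj: "B \<inter> \<Union>\<C> = {}"
      using P unfolding P_def by auto
    have BV: "B \<subseteq> V - X" and Bl: "linked E B"
      and Bcl: "\<And>x y. x \<in> B \<Longrightarrow> y \<in> V \<Longrightarrow> (x, y) \<in> E \<Longrightarrow> y \<in> B \<union> X"
      using bigB unfolding big_def by auto
    have finB: "finite B" by (rule finite_subset[OF _ finV]) (use BV in blast)
    have finX: "finite X" by (rule finite_subset[OF _ finV]) (use XC CV in blast)
    have Cq: "card \<C> * q + q \<le> h * q"
      using mult_le_mono1[OF Suc_leI[OF ch], of q] by simp
    \<comment> \<open>\<open>B'\<close> is connected, avoids \<open>X\<close> and meets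
      \<open>B\<close>, so it cannot leave \<open>B\<close>.\<close>
    have smaller: "B' \<subseteq> B" if "big X' B'" "X \<subseteq> X'" for X' B'
    proof (rule linked_subset)
      show "linked E B'" using that unfolding big_def by blast
      show "B' \<inter> B \<noteq> {}" using big_meet that(1) bigB by blast
      show "y \<in> B" if "x \<in> B" "y \<in> B'" "(x, y) \<in> E" for x y
        using Bcl[OF that(1) _ that(3)] that(2) \<open>big X' B'\<close> \<open>X \<subseteq> X'\<close> unfolding big_def by blast
    qed
    define A where "A C = {v\<in>B. \<exists>x\<in>C. (x, v) \<in> E}" for C
    show ?thesis
    proof (cases "\<exists>C\<in>\<C>. A C = {}")
      case True
      then obtain C where C: "C \<in> \<C>" "A C = {}" by blast
      have "\<And>x y. x \<in> B \<Longrightarrow> (x, y) \<in> E \<Longrightarrow> y \<notin> C"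
        using C(2) symD[OF symE] unfolding A_def by blast
      then have "big (X - C) B" using bigB unfolding big_def by blast
      moreover have "X - C \<subseteq> \<Union>(\<C> - {C})" using XC by blast
      moreover have "card ((X - C) \<inter> D) \<le> q" if "D \<in> \<C> - {C}" for D
      proof -
        have "card ((X - C) \<inter> D) \<le> card (X \<inter> D)"
          using finX by (intro card_mono) (simp, blast)
        then show ?thesis using Xq[of D] that by simp
      qed
      moreover have "clique_model E (\<C> - {C})" using clique_model_subset[OF model] by blast
      moreover have "card (\<C> - {C}) < card \<C>" using C fC by (meson card_Diff1_less)
      ultimately have "P (\<C> - {C}) (X - C) B"
        unfolding P_def using fC ch CV disj by auto
      with \<open>card (\<C> - {C}) < card \<C>\<close> show ?thesis
        by (intro exI conjI) (assumption, simp)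
    next
      case False
      show ?thesis
      proof (rule disjE[OF small_linked_or_separator[OF symE finB fC q(1), of A]])
        assume "\<exists>T\<subseteq>B. linked E T \<and> card T \<le> q \<and> (\<forall>C\<in>\<C>. T \<inter> A C \<noteq> {})"
        then obtain T where tree: "T \<subseteq> B" "linked E T" "card T \<le> q" "\<forall>C\<in>\<C>. T \<inter> A C \<noteq> {}"
          by blast
        have Tne: "T \<noteq> {}" using linked_nonempty[OF tree(2)] .
        have TnC: "T \<notin> \<C>" using tree(1) disj Tne by blast
        have TV: "T \<subseteq> V" using tree(1) BV by blast
        have model': "clique_model E (insert T \<C>)"
        proof (rule clique_model_insert[OF symE model tree(2)])
          show "disjnt T C" if "C \<in> \<C>" for C
            using that tree(1) disj unfolding disjnt_def by blast
          show "\<exists>x\<in>C. \<exists>y\<in>T. (x, y) \<in> E" if "C \<in> \<C>" for C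
            using tree(4) that unfolding A_def by blast
        qed
        have cT: "card (insert T \<C>) = Suc (card \<C>)" using TnC fC by simp
        have ch': "card (insert T \<C>) < h"
          using no_model[OF model'] cT ch CV TV fC by force
        have Xq': "\<forall>C\<in>insert T \<C>. card ((X \<union> T) \<inter> C) \<le> q"
        proof
          fix C assume "C \<in> insert T \<C>"
          moreover have "(X \<union> T) \<inter> T = T" by blast
          moreover have "(X \<union> T) \<inter> C = X \<inter> C" if "C \<in> \<C>" using that tree(1) disj by blast
          ultimately show "card ((X \<union> T) \<inter> C) \<le> q" using Xq tree(3) by auto
        qed
        have XC': "X \<union> T \<subseteq> \<Union>(insert T \<C>)" using XC by blast
        have "card (X \<union> T) \<le> h * q"
          using card_X[OF _ XC' Xq'] fC cT Cq by auto
        then obtain B' where B': "big (X \<union> T) B'"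
          using ex_big[of "X \<union> T"] BV XC CV TV by blast
        have "B' \<subseteq> B" using smaller[OF B'] by blast
        moreover have BT: "B' \<inter> T = {}" using B' unfolding big_def by blast
        ultimately have "B' \<subset> B" using Tne tree(1) by blast
        then have "card B' < card B" using finB psubset_card_mono by blast
        moreover have "P (insert T \<C>) (X \<union> T) B'"
          unfolding P_def using fC ch' model' CV TV XC' Xq' B' \<open>B' \<subseteq> B\<close> BT disj by auto
        \<comment> \<open>The measure counts \<open>B\<close> twice, so losing a vertex of
          \<open>B\<close> outweighs the extra branch set.\<close>
        ultimately show ?thesis using cT by (intro exI[of _ "insert T \<C>"] exI conjI) auto
      next
        assume "\<exists>Z\<subseteq>B. card Z * q \<le> 2 ^ card \<C> * card B \<and>
            (\<forall>U\<subseteq>B - Z. linked E U \<longrightarrow> (\<exists>C\<in>\<C>. U \<inter> A C = {}))"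
        then obtain Z where sep: "Z \<subseteq> B" "card Z * q \<le> 2 ^ card \<C> * card B"
            "\<And>U. U \<subseteq> B - Z \<Longrightarrow> linked E U \<Longrightarrow> \<exists>C\<in>\<C>. U \<inter> A C = {}"
          by blast
        have fZ: "finite Z" using finite_subset[OF sep(1) finB] .
        have "(2::nat) ^ card \<C> \<le> 2 ^ h" using ch by simp
        moreover have "card B \<le> card V" using card_mono[OF finV, of B] BV by blast
        ultimately have "card Z * q \<le> 2 ^ h * card V"
          using sep(2) mult_le_mono le_trans by blast
        then have "card Z * q \<le> q * q" using q(2) by linarith
        then have cZ: "card Z \<le> q" using q(1) by simp
        have "card (X \<union> Z) \<le> card \<C> * q + q"
          using card_Un_le[of X Z] card_X[OF fC XC] Xq cZ by fastforce
        then have "card (X \<union> Z) \<le> h * q" using Cq by simp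
        then obtain D where D: "big (X \<union> Z) D"
          using ex_big[of "X \<union> Z"] sep(1) BV XC CV by blast
        have DB: "D \<subseteq> B" using smaller[OF D] by blast
        have DZ: "D \<inter> Z = {}" "linked E D" using D unfolding big_def by auto
        \<comment> \<open>\<open>D\<close> is connected and avoids \<open>Z\<close>, so some branch
          set \<open>C\<close> has no neighbour in \<open>D\<close>.\<close>
        then obtain C where C: "C \<in> \<C>" "D \<inter> A C = {}" using sep(3)[of D] DB by blast
        have CD: "\<And>x y. x \<in> C \<Longrightarrow> (x, y) \<in> E \<Longrightarrow> y \<notin> D"
          using C(2) DB unfolding A_def by blast
        text \<open>
          \<open>Z\<close> need not be reachable from \<open>C\<close> within \<open>B - D\<close>; only the part \<open>W \<inter> Z\<close> can be absorbed
          into the branch set, and the rest of \<open>Z\<close> returns to the large side.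
        \<close>
        have Cl: "linked E C" using model C unfolding clique_model_def by blast
        obtain c where c: "c \<in> C" using linked_nonempty[OF Cl] by blast
        define W where "W = component E (C \<union> (B - D)) c"
        have CW: "C \<subseteq> W" unfolding W_def using linked_subset_component[OF Cl _ c] by blast
        have Wl: "linked E W" unfolding W_def using linked_component[OF symE] c by blast
        have WS: "W \<subseteq> C \<union> (B - D)" unfolding W_def by (rule component_subset)
        have Wcl: "\<And>x y. x \<in> W \<Longrightarrow> (x, y) \<in> E \<Longrightarrow> y \<in> C \<union> (B - D) \<Longrightarrow> y \<in> W"
          unfolding W_def by (rule component.step)
        have CB: "C \<inter> B = {}" using disj C by blast
        \<comment> \<open>\<open>X \<inter> C\<close> is given back and \<open>W \<inter> Z\<close>
          takes its place. As \<open>B\<close> avoids \<open>X\<close>, the new branch set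
          \<open>W\<close> meets \<open>X'\<close> only in \<open>Z\<close>, hence in at most
          \<open>q\<close> vertices.\<close>
        define X' where "X' = (X - C) \<union> (W \<inter> Z)"
        define \<C>' where "\<C>' = insert W (\<C> - {C})"
        have dC: "disjnt C F" if "F \<in> \<C> - {C}" for F
          using model C that unfolding clique_model_def pairwise_def by auto
        have WF: "W \<inter> F = {}" if "F \<in> \<C> - {C}" for F
          using dC[OF that] WS disj that unfolding disjnt_def by blast
        have model': "clique_model E \<C>'"
          unfolding \<C>'_def
        proof (rule clique_model_insert[OF symE _ Wl])
          show "clique_model E (\<C> - {C})" using clique_model_subset[OF model] by blast
          show "disjnt W F" if "F \<in> \<C> - {C}" for F using WF[OF that] unfolding disjnt_def .
          show "\<exists>x\<in>F. \<exists>y\<in>W. (x, y) \<in> E" if "F \<in> \<C> - {C}" for F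
          proof -
            have "F \<in> \<C>" "F \<noteq> C" using that by auto
            then have "\<exists>x\<in>F. \<exists>y\<in>C. (x, y) \<in> E"
              using model C(1) unfolding clique_model_def by metis
            then show ?thesis using CW by blast
          qed
        qed
        have fC': "finite \<C>'" unfolding \<C>'_def using fC by simp
        have cC': "card \<C>' \<le> card \<C>"
          unfolding \<C>'_def using card.remove[OF fC C(1)] card_insert_le_m1[of "card \<C>" "\<C> - {C}" W]
            fC by (simp add: card_insert_if)
        have CV': "\<Union>\<C>' \<subseteq> V" unfolding \<C>'_def using CV C WS BV by blast
        have XC': "X' \<subseteq> \<Union>\<C>'" unfolding \<C>'_def X'_def using XC by blast
        have Xq': "\<forall>F\<in>\<C>'. card (X' \<inter> F) \<le> q"
        proof
          fix F assume "F \<in> \<C>'"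
          then consider "F = W" | "F \<in> \<C> - {C}" unfolding \<C>'_def by blast
          then show "card (X' \<inter> F) \<le> q"
          proof cases
            case 1
            have "X' \<inter> F \<subseteq> Z" unfolding X'_def 1 using WS BV by blast
            then show ?thesis using card_mono[OF fZ] cZ le_trans by blast
          next
            case 2
            then have "X' \<inter> F \<subseteq> X \<inter> F" unfolding X'_def using WF by blast
            moreover have "finite (X \<inter> F)" using finX by simp
            ultimately show ?thesis using Xq[of F] 2 card_mono le_trans by blast
          qed
        qed
        have "card X' \<le> h * q"
          using card_X[OF fC' XC' Xq'] mult_le_mono1[OF cC', of q] Cq by linarith
        then obtain B' where B': "big X' B'"
          using ex_big[of X'] XC' CV' by blast
        \<comment> \<open>An edge from \<open>B - W\<close> to a vertex of \<open>W\<close> in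
          \<open>B'\<close> would start in \<open>D\<close>, so its end would lie in
          \<open>W \<inter> Z\<close>, a part of \<open>X'\<close>, which \<open>B'\<close>
          avoids.\<close>
        have B'BW: "B' \<subseteq> B - W"
        proof (rule linked_subset)
          show "linked E B'" using B' unfolding big_def by blast
          have "D \<inter> W = {}" using WS DB CB by blast
          then show "B' \<inter> (B - W) \<noteq> {}" using big_meet[OF B' D] DB by blast
          fix x y
          assume x: "x \<in> B - W" and y: "y \<in> B'" and xy: "(x, y) \<in> E"
          have yV: "y \<in> V" "y \<notin> X'" using B' y unfolding big_def by auto
          have yx: "(y, x) \<in> E" using symD[OF symE xy] .
          have "y \<notin> W"
          proof
            assume yW: "y \<in> W"
            then have xD: "x \<in> D" using Wcl[OF yW yx] x by blast
            then have "y \<notin> C" using CD[of y x] yx by blast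
            then have "y \<in> B - D" using WS yW by blast
            moreover have "y \<in> D \<union> (X \<union> Z)" using D xD yV xy unfolding big_def by blast
            ultimately have "y \<in> Z" using BV by blast
            then show False using yW yV(2) unfolding X'_def by blast
          qed
          moreover have "y \<in> B \<union> X" using Bcl[OF _ yV(1) xy] x by blast
          moreover have "y \<notin> X - C" using yV(2) unfolding X'_def by blast
          ultimately show "y \<in> B - W" using CW by blast
        qed
        \<comment> \<open>This neighbour of \<open>C\<close> lies in \<open>B\<close> but not in
          \<open>D\<close>, hence in \<open>W\<close>, so \<open>B'\<close> misses it.\<close>
        obtain a where a: "a \<in> A C" using False C by blast
        then have aB: "a \<in> B" "a \<notin> D" using C(2) unfolding A_def by blast+
        have "a \<in> W" using a aB CW Wcl unfolding A_def by blast
        then have "B' \<subset> B" using B'BW aB by blast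
        then have "card B' < card B" using finB psubset_card_mono by blast
        moreover have "P \<C>' X' B'"
        proof -
          have "B' \<inter> \<Union>\<C>' = {}" using B'BW disj unfolding \<C>'_def by blast
          then show ?thesis
            unfolding P_def using fC' cC' ch model' CV' XC' Xq' B' by auto
        qed
        ultimately show ?thesis using cC' by (intro exI[of _ \<C>'] exI conjI) auto
      qed
    qed
  qed
  have impossible: "\<not> P \<C> X B" for \<C> X B
  proof (induction "2 * card B + card \<C>" arbitrary: \<C> X B rule: less_induct)
    case less
    then show ?case using descent by blast
  qed
  \<comment> \<open>The empty model rules out \<open>h = 0\<close>, so it has fewer than
    \<open>h\<close> branch sets and can start the descent.\<close>
  have "h \<noteq> 0" using no_model[of "{}"] by (auto simp: clique_model_def)
  moreover obtain B where "big {} B" using ex_big[of "{}"] by auto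
  ultimately have "P {} {} B" unfolding P_def by (auto simp: clique_model_def)
  then show False using impossible by blast
qed

section \<open>Fragmentation\<close>

text \<open>\<open>q\<close> is \<open>sqrt (2 ^ h * card V)\<close> rounded up; for non-empty
  \<open>V\<close> this root is at least 1, so rounding costs at most a factor 2.\<close>

lemma balanced_separator_sqrt:
  assumes "sym E" "finite V"
    and "\<And>\<C>. clique_model E \<C> \<Longrightarrow> \<Union>\<C> \<subseteq> V \<Longrightarrow> finite \<C> \<Longrightarrow> card \<C> \<noteq> h"
  shows "\<exists>X\<subseteq>V. real (card X) \<le> 2 * real h * sqrt (2 ^ h) * sqrt (real (card V)) \<and>
           (\<forall>U\<subseteq>V - X. linked E U \<longrightarrow> 2 * card U \<le> card V)"
proof (cases "V = {}")
  case True
  then show ?thesis using linked_nonempty by auto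
next
  case False
  define s where "s = sqrt (2 ^ h * real (card V))"
  define q where "q = nat \<lceil>s\<rceil>"
  have "1 * 1 \<le> 2 ^ h * real (card V)"
    using False assms(2) by (intro mult_mono) (auto simp: Suc_le_eq card_gt_0_iff)
  then have s1: "1 \<le> s" unfolding s_def by simp
  have qs: "s \<le> real q" "real q \<le> 2 * s" using s1 unfolding q_def by linarith+
  have "real (2 ^ h * card V) = s * s" unfolding s_def by simp
  also have "\<dots> \<le> real q * real q" using qs s1 by (intro mult_mono) auto
  finally have "2 ^ h * card V \<le> q * q" by (metis of_nat_le_iff of_nat_mult)
  moreover have "1 \<le> q" using s1 qs by linarith
  ultimately obtain X where X: "X \<subseteq> V" "card X \<le> h * q"
    "\<forall>U\<subseteq>V - X. linked E U \<longrightarrow> 2 * card U \<le> card V"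
    using balanced_separator[OF assms, of q] by blast
  have "real (card X) \<le> real h * real q" using X(2) by (metis of_nat_le_iff of_nat_mult)
  also have "\<dots> \<le> real h * (2 * s)" using qs by (intro mult_left_mono) auto
  also have "\<dots> = 2 * real h * sqrt (2 ^ h) * sqrt (real (card V))"
    unfolding s_def by (simp add: real_sqrt_mult)
  finally show ?thesis using X by blast
qed

text \<open>Only components with more than \<open>m\<close> vertices are cut. They are disjoint, so
  there are at most \<open>card V / m\<close> of them, and each has at most \<open>2 * m\<close>
  vertices, so its separator costs at most \<open>c * sqrt (2 * m)\<close>.\<close>

lemma halve_components:
  assumes symE: "sym E" and finV: "finite V" and XV: "X \<subseteq> V" and m: "m \<ge> 1" and c: "c \<ge> 0"
    and sep: "\<And>K. K \<subseteq> V \<Longrightarrow> \<exists>Y\<subseteq>K. real (card Y) \<le> c * sqrt (real (card K)) \<and>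
           (\<forall>U\<subseteq>K - Y. linked E U \<longrightarrow> 2 * card U \<le> card K)"
    and small: "\<And>U. U \<subseteq> V - X \<Longrightarrow> linked E U \<Longrightarrow> card U \<le> 2 * m"
  shows "\<exists>X'\<subseteq>V. real (card X') \<le> real (card X) + real (card V) / real m * (c * sqrt (2 * real m)) \<and>
           (\<forall>U\<subseteq>V - X'. linked E U \<longrightarrow> card U \<le> m)"
proof -
  define \<K> where "\<K> = {K \<in> component E (V - X) ` (V - X). m < card K}"
  have sub: "K \<subseteq> V - X" if "K \<in> \<K>" for K
    using that component_subset[of E "V - X"] unfolding \<K>_def by auto
  have lnk: "linked E K" if "K \<in> \<K>" for K
    using that linked_component[OF symE] unfolding \<K>_def by blast
  have finK: "finite \<K>" unfolding \<K>_def using finV by simp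
  have "pairwise disjnt \<K>"
    using disjnt_components[OF symE] unfolding \<K>_def by (rule pairwise_subset) blast
  then have "(\<Sum>K\<in>\<K>. card K) = card (\<Union>\<K>)"
    by (intro card_Union_disjoint[symmetric] finite_subset[OF _ finV]) (use sub in blast)+
  also have "\<dots> \<le> card V" using sub finV by (intro card_mono) auto
  finally have sumK: "(\<Sum>K\<in>\<K>. card K) \<le> card V" .
  have "card \<K> * m \<le> (\<Sum>K\<in>\<K>. card K)"
    using sum_bounded_below[of \<K> m card] unfolding \<K>_def by fastforce
  then have "card \<K> * m \<le> card V" using sumK by linarith
  then have "real (card \<K>) * real m \<le> real (card V)" by (metis of_nat_le_iff of_nat_mult)
  then have cardK: "real (card \<K>) \<le> real (card V) / real m"
    using m by (simp add: pos_le_divide_eq)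
  have "\<exists>Y. Y \<subseteq> K \<and> real (card Y) \<le> c * sqrt (real (card K)) \<and>
           (\<forall>U\<subseteq>K - Y. linked E U \<longrightarrow> 2 * card U \<le> card K)" if "K \<in> \<K>" for K
    using sep[of K] sub[OF that] by blast
  then obtain Y where Y: "\<And>K. K \<in> \<K> \<Longrightarrow> Y K \<subseteq> K"
    "\<And>K. K \<in> \<K> \<Longrightarrow> real (card (Y K)) \<le> c * sqrt (real (card K))"
    "\<And>K U. K \<in> \<K> \<Longrightarrow> U \<subseteq> K - Y K \<Longrightarrow> linked E U \<Longrightarrow> 2 * card U \<le> card K"
    by metis
  have le2m: "card K \<le> 2 * m" if "K \<in> \<K>" for K using small sub[OF that] lnk[OF that] by blast
  define X' where "X' = X \<union> \<Union>(Y ` \<K>)"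
  have "Y K \<subseteq> V" if "K \<in> \<K>" for K using Y(1)[OF that] sub[OF that] by blast
  then have X'V: "X' \<subseteq> V" unfolding X'_def using XV by blast
  have "real (card X') \<le> real (card X) + (\<Sum>K\<in>\<K>. real (card (Y K)))"
  proof -
    have "card X' \<le> card X + (\<Sum>K\<in>\<K>. card (Y K))"
      unfolding X'_def using card_Un_le[of X "\<Union>(Y ` \<K>)"] card_UN_le[OF finK, of Y] by linarith
    then show ?thesis by (metis of_nat_add of_nat_le_iff of_nat_sum)
  qed
  also have "(\<Sum>K\<in>\<K>. real (card (Y K))) \<le> (\<Sum>K\<in>\<K>. c * sqrt (2 * real m))"
  proof (rule sum_mono)
    fix K assume K: "K \<in> \<K>"
    have "sqrt (real (card K)) \<le> sqrt (2 * real m)" using le2m[OF K] by simp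
    then show "real (card (Y K)) \<le> c * sqrt (2 * real m)"
      using Y(2)[OF K] c by (meson mult_left_mono order_trans)
  qed
  also have "\<dots> = real (card \<K>) * (c * sqrt (2 * real m))" by simp
  also have "\<dots> \<le> real (card V) / real m * (c * sqrt (2 * real m))"
    using cardK c by (intro mult_right_mono) auto
  finally have card_X': "real (card X') \<le> real (card X) + real (card V) / real m * (c * sqrt (2 * real m))"
    by simp
  have "card U \<le> m" if U: "U \<subseteq> V - X'" "linked E U" for U
  proof -
    obtain u where u: "u \<in> U" using linked_nonempty[OF U(2)] by blast
    have UX: "U \<subseteq> V - X" using U(1) unfolding X'_def by blast
    define K where "K = component E (V - X) u"
    have UK: "U \<subseteq> K" unfolding K_def by (rule linked_subset_component[OF U(2) UX u])
    have KV: "K \<subseteq> V - X" unfolding K_def by (rule component_subset)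
    show ?thesis
    proof (cases "m < card K")
      case True
      then have K: "K \<in> \<K>" unfolding \<K>_def K_def using u UX by blast
      have "U \<subseteq> K - Y K" using UK U(1) K unfolding X'_def by blast
      then show ?thesis using Y(3)[OF K _ U(2)] le2m[OF K] by fastforce
    next
      case False
      have "finite K" by (rule finite_subset[OF _ finV]) (use KV in blast)
      then have "card U \<le> card K" using UK by (rule card_mono)
      then show ?thesis using False by simp
    qed
  qed
  then show ?thesis using X'V card_X' by blast
qed

text \<open>Multiplying by \<open>sqrt m\<close> reduces this to \<open>sqrt 2 \<le> 10 / 7\<close>,
  which is why the constant 5 works. Up to the factor \<open>c\<close>, the left side is the cost of
  one halving per vertex of the graph.\<close>

lemma fragmentation_step:
  fixes m :: real
  assumes "m > 0"
  shows "sqrt (2 * m) / m \<le> 5 / sqrt m - 5 / sqrt (2 * m)"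
proof -
  have "sqrt m * sqrt m = m" using assms by simp
  then have "sqrt (2 * m) / m = sqrt 2 / sqrt m"
    using assms by (simp add: real_sqrt_mult field_simps)
  moreover have "5 / sqrt (2 * m) = (5 / 2 * sqrt 2) / sqrt m"
    using assms by (simp add: real_sqrt_mult field_simps)
  moreover have "sqrt 2 / sqrt m \<le> (5 - 5 / 2 * sqrt 2) / sqrt m"
  proof (rule divide_right_mono)
    have "sqrt 2 \<le> 10 / 7" by (rule real_le_lsqrt) (simp_all add: power2_eq_square)
    then show "sqrt 2 \<le> 5 - 5 / 2 * sqrt 2" by linarith
  qed (use assms in simp)
  ultimately show ?thesis by (simp add: diff_divide_distrib)
qed

text \<open>
  The costs of successive halvings form a geometric series, which telescopes against
  \<open>5 c |V| / \<surd>m\<close>.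
\<close>

lemma fragmentation_levels:
  fixes M :: nat
  assumes symE: "sym E" and finV: "finite V" and M: "M \<ge> 1" and c: "c \<ge> 0"
    and sep: "\<And>K. K \<subseteq> V \<Longrightarrow> \<exists>Y\<subseteq>K. real (card Y) \<le> c * sqrt (real (card K)) \<and>
           (\<forall>U\<subseteq>K - Y. linked E U \<longrightarrow> 2 * card U \<le> card K)"
  shows "X \<subseteq> V \<Longrightarrow> (\<And>U. U \<subseteq> V - X \<Longrightarrow> linked E U \<Longrightarrow> card U \<le> 2 ^ i * M) \<Longrightarrow>
    \<exists>X'\<subseteq>V. real (card X') \<le> real (card X) +
        real (card V) * c * (5 / sqrt (real M) - 5 / sqrt (real (2 ^ i * M))) \<and>
      (\<forall>U\<subseteq>V - X'. linked E U \<longrightarrow> card U \<le> M)"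
proof (induction i arbitrary: X)
  case 0
  then show ?case by (intro exI[of _ X]) auto
next
  case (Suc i)
  let ?m = "2 ^ i * M"
  have m: "?m \<ge> 1" using M by simp
  have "\<And>U. U \<subseteq> V - X \<Longrightarrow> linked E U \<Longrightarrow> card U \<le> 2 * ?m" using Suc(3) by (simp add: mult.assoc)
  then obtain X1 where X1: "X1 \<subseteq> V"
    "real (card X1) \<le> real (card X) + real (card V) / real ?m * (c * sqrt (2 * real ?m))"
    "\<And>U. U \<subseteq> V - X1 \<Longrightarrow> linked E U \<Longrightarrow> card U \<le> ?m"
    using halve_components[OF symE finV Suc(2) m c sep] by blast
  obtain X' where X': "X' \<subseteq> V" "real (card X') \<le> real (card X1) +
        real (card V) * c * (5 / sqrt (real M) - 5 / sqrt (real ?m))"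
      "\<forall>U\<subseteq>V - X'. linked E U \<longrightarrow> card U \<le> M"
    using Suc(1)[OF X1(1,3)] by blast
  have "real (card V) / real ?m * (c * sqrt (2 * real ?m)) =
      real (card V) * c * (sqrt (2 * real ?m) / real ?m)" by simp
  also have "\<dots> \<le> real (card V) * c * (5 / sqrt (real ?m) - 5 / sqrt (2 * real ?m))"
    using fragmentation_step[of "real ?m"] m c by (intro mult_left_mono) auto
  finally have "real (card X') \<le> real (card X) +
      real (card V) * c * (5 / sqrt (real ?m) - 5 / sqrt (2 * real ?m)) +
      real (card V) * c * (5 / sqrt (real M) - 5 / sqrt (real ?m))"
    using X1(2) X'(2) by linarith
  also have "\<dots> = real (card X) +
      real (card V) * c * (5 / sqrt (real M) - 5 / sqrt (real (2 ^ Suc i * M)))"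
    by (simp add: algebra_simps)
  finally show ?case using X' by blast
qed

theorem fragmentation:
  fixes \<epsilon> :: real
  assumes "\<epsilon> > 0"
  shows "\<exists>M\<ge>1. \<forall>(V :: 'a set) E. sym E \<longrightarrow> finite V \<longrightarrow>
    (\<forall>\<C>. clique_model E \<C> \<longrightarrow> \<Union>\<C> \<subseteq> V \<longrightarrow> finite \<C> \<longrightarrow> card \<C> \<noteq> h) \<longrightarrow>
    (\<exists>X\<subseteq>V. real (card X) \<le> \<epsilon> * real (card V) \<and> (\<forall>U\<subseteq>V - X. linked E U \<longrightarrow> card U \<le> M))"
proof -
  define c where "c = 2 * real h * sqrt (2 ^ h)"
  have c: "c \<ge> 0" unfolding c_def by simp
  \<comment> \<open>Chosen so that the telescoped total \<open>5 * c / sqrt M\<close> is at most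
    \<open>\<epsilon>\<close>; \<open>M\<close> depends only on \<open>\<epsilon>\<close> and
    \<open>h\<close>.\<close>
  define M where "M = nat \<lceil>(5 * c / \<epsilon>)\<^sup>2\<rceil> + 1"
  have M: "M \<ge> 1" unfolding M_def by simp
  have "(5 * c / \<epsilon>)\<^sup>2 \<le> real M" unfolding M_def by linarith
  then have "5 * c / \<epsilon> \<le> sqrt (real M)" by (rule real_le_rsqrt)
  then have cM: "c * (5 / sqrt (real M)) \<le> \<epsilon>"
    using assms M by (simp add: field_simps)
  have frag: "\<exists>X\<subseteq>V. real (card X) \<le> \<epsilon> * real (card V) \<and> (\<forall>U\<subseteq>V - X. linked E U \<longrightarrow> card U \<le> M)"
    if symE: "sym E" and finV: "finite V"
      and nm: "\<forall>\<C>. clique_model E \<C> \<longrightarrow> \<Union>\<C> \<subseteq> V \<longrightarrow> finite \<C> \<longrightarrow> card \<C> \<noteq> h"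
    for V :: "'a set" and E
  proof -
    have sep: "\<exists>Y\<subseteq>K. real (card Y) \<le> c * sqrt (real (card K)) \<and>
           (\<forall>U\<subseteq>K - Y. linked E U \<longrightarrow> 2 * card U \<le> card K)" if "K \<subseteq> V" for K
      unfolding c_def
      using that by (intro balanced_separator_sqrt[OF symE finite_subset[OF that finV]]) (use nm in blast)
    \<comment> \<open>From an empty \<open>X\<close>, \<open>card V\<close> halvings suffice; the
      telescoped bound does not grow with their number.\<close>
    have "card U \<le> 2 ^ card V * M" if "U \<subseteq> V - {}" for U
    proof -
      have "card U \<le> card V" using that finV by (intro card_mono) auto
      also have "\<dots> \<le> 2 ^ card V" by simp
      also have "\<dots> \<le> 2 ^ card V * M" using M by simp
      finally show ?thesis .
    qed
    then have "\<exists>X\<subseteq>V. real (card X) \<le> real (card ({} :: 'a set)) +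
          real (card V) * c * (5 / sqrt (real M) - 5 / sqrt (real (2 ^ card V * M))) \<and>
        (\<forall>U\<subseteq>V - X. linked E U \<longrightarrow> card U \<le> M)"
      by (intro fragmentation_levels[OF symE finV M c sep]) auto
    then obtain X where X: "X \<subseteq> V" "real (card X) \<le>
        real (card V) * c * (5 / sqrt (real M) - 5 / sqrt (real (2 ^ card V * M)))"
      "\<forall>U\<subseteq>V - X. linked E U \<longrightarrow> card U \<le> M"
      by auto
    have "real (card V) * c * (5 / sqrt (real M) - 5 / sqrt (real (2 ^ card V * M)))
        \<le> real (card V) * c * (5 / sqrt (real M))"
      using c by (intro mult_left_mono) auto
    also have "\<dots> \<le> real (card V) * \<epsilon>"
      using cM by (simp only: mult.assoc) (intro mult_left_mono, auto)
    finally have "real (card X) \<le> \<epsilon> * real (card V)" using X(2) by (simp add: mult.commute)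
    then show ?thesis using X by blast
  qed
  show ?thesis by (intro exI[of _ M] conjI allI impI M) (rule frag)
qed

section \<open>Percolation and islands\<close>

lemma connected_if_linked:
  assumes "linked (parcs G) T"
  shows "Digraph_Component.connected (with_proj G \<restriction> T)"
proof -
  let ?S = "mk_symmetric (with_proj G \<restriction> T)"
  have verts: "pverts ?S = T" by simp
  have arc: "(x, y) \<in> parcs ?S" if "x \<in> T" "y \<in> T" "(x, y) \<in> parcs G" for x y
    using that unfolding parcs_mk_symmetric by force
  have "(u, v) \<in> rtrancl_on T (parcs ?S)" if u: "u \<in> T" and v: "v \<in> T" for u v
  proof -
    have "T \<subseteq> {w. (u, w) \<in> rtrancl_on T (parcs ?S)}"
    proof (rule linked_subset[OF assms])
      show "T \<inter> {w. (u, w) \<in> rtrancl_on T (parcs ?S)} \<noteq> {}" using u by blast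
      show "y \<in> {w. (u, w) \<in> rtrancl_on T (parcs ?S)}"
        if "x \<in> T" "x \<in> {w. (u, w) \<in> rtrancl_on T (parcs ?S)}" "y \<in> T" "(x, y) \<in> parcs G" for x y
        using that arc by (auto intro: rtrancl_on_into_rtrancl_on)
    qed
    then show ?thesis using v by blast
  qed
  then show ?thesis
    unfolding connected_def strongly_connected_def reachable_def
    using linked_nonempty[OF assms] by simp
qed

text \<open>Any bijection from the vertices of \<open>H\<close> to the branch sets works, since
  distinct branch sets are adjacent and \<open>H\<close> has no loops.\<close>

lemma is_minor_if_clique_model:
  assumes H: "pair_graph H"
    and model: "clique_model (parcs G) \<C>" "\<Union>\<C> \<subseteq> pverts G" "finite \<C>" "card \<C> = card (pverts H)"
  shows "is_minor H G"
proof -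
  interpret pair_graph H by fact
  obtain f where f: "bij_betw f (pverts H) \<C>"
    using finite_same_card_bij[OF pair_finite_verts model(3)] model(4) by metis
  have fC: "f v \<in> \<C>" if "v \<in> pverts H" for v using bij_betwE[OF f] that by blast
  have finj: "f u \<noteq> f v" if "u \<in> pverts H" "v \<in> pverts H" "u \<noteq> v" for u v
    using inj_onD[OF bij_betw_imp_inj_on[OF f] _ that(1,2)] that(3) by blast
  have model_linked: "\<And>C. C \<in> \<C> \<Longrightarrow> linked (parcs G) C"
    and model_disjnt: "\<And>C D. C \<in> \<C> \<Longrightarrow> D \<in> \<C> \<Longrightarrow> C \<noteq> D \<Longrightarrow> C \<inter> D = {}"
    and model_adj: "\<And>C D. C \<in> \<C> \<Longrightarrow> D \<in> \<C> \<Longrightarrow> C \<noteq> D \<Longrightarrow> \<exists>x\<in>C. \<exists>y\<in>D. (x, y) \<in> parcs G"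
    using model(1) unfolding clique_model_def pairwise_def disjnt_def by simp_all
  have "f v \<subseteq> pverts G \<and> Digraph_Component.connected (with_proj G \<restriction> f v)" if "v \<in> pverts H" for v
    using fC[OF that] model(2) connected_if_linked[OF model_linked] by blast
  moreover have "disjoint_family_on f (pverts H)"
    unfolding disjoint_family_on_def
    using model_disjnt[OF fC fC finj] by blast
  moreover have "\<exists>x\<in>f u. \<exists>y\<in>f v. (x, y) \<in> parcs G" if "(u, v) \<in> parcs H" for u v
  proof -
    have "u \<in> pverts H" "v \<in> pverts H" "u \<noteq> v"
      using in_arcsD1[OF that] in_arcsD2[OF that] no_loops'[OF that] by blast+
    then show ?thesis using model_adj[OF fC fC finj] by blast
  qed
  ultimately show ?thesis unfolding is_minor_def by blast
qed

section \<open>Activation sequences\<close>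

lemma activation_subset: "activation t G A B \<Longrightarrow> A \<subseteq> pverts G \<Longrightarrow> B \<subseteq> pverts G"
  by (auto elim: activation.cases)

lemma activations_subset: "(activation t G)\<^sup>*\<^sup>* A B \<Longrightarrow> A \<subseteq> pverts G \<Longrightarrow> B \<subseteq> pverts G"
  by (induction rule: rtranclp_induct) (auto dest: activation_subset)

lemma activations_mono:
  assumes "finite (pverts G)" "(activation t G)\<^sup>*\<^sup>* A B" "A \<union> D \<subseteq> pverts G"
  shows "(activation t G)\<^sup>*\<^sup>* (A \<union> D) (B \<union> D)"
  using assms(2)
proof (induction rule: rtranclp_induct)
  case base
  then show ?case by simp
next
  case (step B C)
  from step(2) obtain v where v: "v \<in> pverts G - B" "t \<le> card (nbrs G v \<inter> B)" "C = insert v B"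
    by (auto elim: activation.cases)
  show ?case
  proof (cases "v \<in> D")
    case True
    then have "C \<union> D = B \<union> D" using v by blast
    then show ?thesis using step by simp
  next
    case False
    have "B \<union> D \<subseteq> pverts G" using activations_subset[OF step(1)] assms(3) by blast
    then have "finite (nbrs G v \<inter> (B \<union> D))" using finite_subset[OF _ assms(1)] by simp
    then have "card (nbrs G v \<inter> B) \<le> card (nbrs G v \<inter> (B \<union> D))" by (rule card_mono) blast
    then have "activation t G (B \<union> D) (insert v (B \<union> D))"
      using v False by (intro activation.intros) auto
    then show ?thesis using step(3) v(3) by simp
  qed
qed

text \<open>The first vertex of \<open>S\<close> to become active would need \<open>t\<close> active
  neighbours, all outside \<open>S\<close>, but it has fewer than \<open>t\<close> neighbours
  there.\<close>

lemma percolating_meets_island: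
  assumes "finite (pverts G)" "is_island t G S" "percolates t G A"
  shows "S \<inter> A \<noteq> {}"
proof
  assume disj: "S \<inter> A = {}"
  have S: "S \<noteq> {}" "S \<subseteq> pverts G" and few: "\<And>v. v \<in> S \<Longrightarrow> card (nbrs G v \<inter> (pverts G - S)) < t"
    using assms(2) unfolding is_island_def by auto
  have A: "A \<subseteq> pverts G" "(activation t G)\<^sup>*\<^sup>* A (pverts G)"
    using assms(3) unfolding percolates_def by auto
  have "S \<inter> B = {} \<and> B \<subseteq> pverts G" if "(activation t G)\<^sup>*\<^sup>* A B" for B
    using that
  proof (induction rule: rtranclp_induct)
    case base
    then show ?case using disj A by blast
  next
    case (step B C)
    from step(2) obtain v where v: "v \<in> pverts G - B" "t \<le> card (nbrs G v \<inter> B)" "C = insert v B"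
      by (auto elim: activation.cases)
    have "card (nbrs G v \<inter> B) \<le> card (nbrs G v \<inter> (pverts G - S))"
      using step(3) assms(1) by (intro card_mono) auto
    then have "v \<notin> S" using few[of v] v(2) by linarith
    then show ?case using v step(3) by auto
  qed
  then show False using A(2) S by blast
qed

text \<open>A percolating set contains a vertex of each island, and these are distinct. Both size
  bounds are non-strict, so halving \<open>\<epsilon>\<close> provides the strict
  contradiction.\<close>

lemma resistant_if_islands:
  assumes "finite (pverts G)" "pverts G \<noteq> {}" "\<epsilon> > 0"
    and "\<forall>S\<in>\<I>. is_island t G S" "pairwise disjnt \<I>" "real (card \<I>) \<ge> \<epsilon> * real (card (pverts G))"
  shows "resistant (\<epsilon> / 2) t G"
  unfolding resistant_def
proof (intro allI impI notI)
  fix A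
  assume A: "A \<subseteq> pverts G" "real (card A) \<le> \<epsilon> / 2 * real (card (pverts G))" "percolates t G A"
  have "\<exists>a. a \<in> S \<inter> A" if "S \<in> \<I>" for S
    using percolating_meets_island[OF assms(1) _ A(3)] assms(4) that by blast
  then obtain f where f: "\<And>S. S \<in> \<I> \<Longrightarrow> f S \<in> S \<inter> A" by metis
  have "inj_on f \<I>"
  proof (rule inj_onI)
    fix S T assume ST: "S \<in> \<I>" "T \<in> \<I>" "f S = f T"
    then show "S = T" using f[of S] f[of T] assms(5) unfolding pairwise_def disjnt_iff by (metis IntD1)
  qed
  moreover have "f ` \<I> \<subseteq> A" using f by blast
  ultimately have "card \<I> \<le> card A"
    using card_inj_on_le[OF _ _ finite_subset[OF A(1) assms(1)]] by blast
  moreover have "0 < \<epsilon> * real (card (pverts G))" using assms by (simp add: card_gt_0_iff)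
  ultimately show False using A(2) assms(6) by auto
qed

text \<open>Half of the resistance bound pays for \<open>X\<close>. The vertices that stay inactive
  complete \<open>X\<close> to a percolating set, so they must exceed the other half, and each
  island accounts for at most \<open>M\<close> of them.\<close>

lemma islands_if_resistant:
  assumes G: "pair_graph G" and M: "M \<ge> 1" and \<epsilon>: "\<epsilon> > 0"
    and X: "X \<subseteq> pverts G" "real (card X) \<le> \<epsilon> / 2 * real (card (pverts G))"
    and small: "\<And>U. U \<subseteq> pverts G - X \<Longrightarrow> linked (parcs G) U \<Longrightarrow> card U \<le> M"
    and res: "resistant \<epsilon> t G"
  shows "\<exists>\<I>. (\<forall>S\<in>\<I>. is_island t G S) \<and> pairwise disjnt \<I> \<and>
            real (card \<I>) \<ge> \<epsilon> / (2 * real M) * real (card (pverts G))"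
proof -
  interpret pair_graph G by fact
  let ?V = "pverts G"
  have symE: "sym (parcs G)" using arcs_symmetric by (auto intro: symI)
  have finV: "finite ?V" by (rule pair_finite_verts)
  let ?F = "{A. (activation t G)\<^sup>*\<^sup>* X A}"
  have "?F \<subseteq> Pow ?V" using activations_subset X(1) by blast
  then have "finite ?F" by (rule finite_subset) (simp add: finV)
  moreover have "?F \<noteq> {}" by blast
  \<comment> \<open>A maximal reachable set admits no further activation, so it is the final active
    set.\<close>
  ultimately obtain A where A: "(activation t G)\<^sup>*\<^sup>* X A"
    and maxA: "\<And>B. (activation t G)\<^sup>*\<^sup>* X B \<Longrightarrow> A \<subseteq> B \<Longrightarrow> A = B"
    using finite_has_maximal[of ?F] by (metis (mono_tags, lifting) mem_Collect_eq)
  have AV: "A \<subseteq> ?V" using activations_subset[OF A X(1)] .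
  have XA: "X \<subseteq> A"
    using A by (induction rule: rtranclp_induct) (auto elim: activation.cases)
  have few: "card (nbrs G v \<inter> A) < t" if "v \<in> ?V - A" for v
  proof (rule ccontr)
    assume "\<not> ?thesis"
    then have "activation t G A (insert v A)" using that by (intro activation.intros) auto
    then have "A = insert v A" using A maxA[of "insert v A"] by (auto intro: rtranclp.rtrancl_into_rtrancl)
    then show False using that by blast
  qed
  define \<K> where "\<K> = component (parcs G) (?V - X) ` (?V - X)"
  define \<I> where "\<I> = (\<lambda>K. K - A) ` \<K> - {{}}"
  have sub: "K \<subseteq> ?V - X" if "K \<in> \<K>" for K using that component_subset[of "parcs G" "?V - X"] unfolding \<K>_def by auto
  have finI: "finite \<I>" unfolding \<I>_def \<K>_def using finV by simp
  have "is_island t G S" if S: "S \<in> \<I>" for S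
    unfolding is_island_def
  proof (intro conjI ballI)
    obtain K where K: "K \<in> \<K>" "S = K - A" using S unfolding \<I>_def by blast
    show "S \<noteq> {}" using S unfolding \<I>_def by blast
    show "S \<subseteq> ?V" using K sub by blast
    fix v assume v: "v \<in> S"
    \<comment> \<open>An inactive neighbour of \<open>v\<close> is outside \<open>X\<close>, hence
      in the component \<open>K\<close> of \<open>v\<close>, hence in \<open>S\<close>.\<close>
    have "nbrs G v \<inter> (?V - S) \<subseteq> nbrs G v \<inter> A"
    proof
      fix u assume u: "u \<in> nbrs G v \<inter> (?V - S)"
      have "u \<in> A"
      proof (rule ccontr)
        assume "u \<notin> A"
        then have "u \<in> ?V - X" using u XA by blast
        then have "u \<in> K"
          using K v u component.step[of v "parcs G" "?V - X" _ u] unfolding \<K>_def nbrs_def by blast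
        then show False using u K \<open>u \<notin> A\<close> by blast
      qed
      then show "u \<in> nbrs G v \<inter> A" using u by blast
    qed
    moreover have "finite (nbrs G v \<inter> A)" using finite_subset[OF AV finV] by simp
    ultimately have "card (nbrs G v \<inter> (?V - S)) \<le> card (nbrs G v \<inter> A)" by (metis card_mono)
    also have "\<dots> < t" using few v K sub by blast
    finally show "card (nbrs G v \<inter> (?V - S)) < t" .
  qed
  moreover have "pairwise disjnt \<I>"
  proof (rule pairwiseI)
    fix S T assume ST: "S \<in> \<I>" "T \<in> \<I>" "S \<noteq> T"
    then obtain K L where KL: "K \<in> \<K>" "L \<in> \<K>" "S = K - A" "T = L - A" unfolding \<I>_def by blast
    then have "K \<noteq> L" using ST by blast
    then have "disjnt K L"
      using disjnt_components[OF symE] KL unfolding \<K>_def pairwise_def by blast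
    then show "disjnt S T" unfolding KL disjnt_def by blast
  qed
  moreover have "\<epsilon> / (2 * real M) * real (card ?V) \<le> real (card \<I>)"
  proof (rule ccontr)
    assume "\<not> ?thesis"
    then have few_islands: "real (card \<I>) * real M \<le> \<epsilon> / 2 * real (card ?V)"
      using M by (simp add: field_simps)
    have UI: "\<Union>\<I> = ?V - A"
    proof
      show "\<Union>\<I> \<subseteq> ?V - A" unfolding \<I>_def using sub by blast
      show "?V - A \<subseteq> \<Union>\<I>"
      proof
        fix v assume v: "v \<in> ?V - A"
        then have "v \<in> ?V - X" using XA by blast
        then have "component (parcs G) (?V - X) v \<in> \<K>" "v \<in> component (parcs G) (?V - X) v"
          unfolding \<K>_def using component.base[of v "?V - X" "parcs G"] by auto
        then show "v \<in> \<Union>\<I>" unfolding \<I>_def using v by blast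
      qed
    qed
    have "card S \<le> M" if S: "S \<in> \<I>" for S
    proof -
      obtain K where K: "K \<in> \<K>" "S = K - A" using S unfolding \<I>_def by blast
      have "linked (parcs G) K" using K(1) linked_component[OF symE] unfolding \<K>_def by blast
      then have "card K \<le> M" using small sub[OF K(1)] by blast
      moreover have "finite K" by (rule finite_subset[OF _ finV]) (use sub[OF K(1)] in blast)
      ultimately show ?thesis using K(2) card_mono[of K S] by (metis Diff_subset le_trans)
    qed
    then have "(\<Sum>S\<in>\<I>. card S) \<le> card \<I> * M"
      using sum_bounded_above[of \<I> card M] by simp
    then have "card (\<Union>\<I>) \<le> card \<I> * M" using card_Union_le_sum_card[of \<I>] by linarith
    then have "real (card (?V - A)) \<le> real (card \<I>) * real M"
      unfolding UI by (metis of_nat_le_iff of_nat_mult)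
    then have "real (card (X \<union> (?V - A))) \<le> \<epsilon> * real (card ?V)"
      using few_islands X(2) card_Un_le[of X "?V - A"] by linarith
    moreover have XV: "X \<union> (?V - A) \<subseteq> ?V" using X by blast
    ultimately have "\<not> percolates t G (X \<union> (?V - A))" using res unfolding resistant_def by blast
    moreover have "(activation t G)\<^sup>*\<^sup>* (X \<union> (?V - A)) (A \<union> (?V - A))"
      using activations_mono[OF finV A XV] .
    moreover have "A \<union> (?V - A) = ?V" using AV by blast
    ultimately show False using XV unfolding percolates_def by simp
  qed
  ultimately show ?thesis by blast
qed

theorem theorem16:
  fixes \<G> :: "'a pair_pre_digraph set" and H :: "'b pair_pre_digraph"
  assumes "\<And>G. G \<in> \<G> \<Longrightarrow> pair_graph G"
    and "subgraph_closed \<G>"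
    and "pair_graph H"
    and "\<And>G. G \<in> \<G> \<Longrightarrow> minor_free H G"
  shows "pcol_star \<G> = percolation_threshold \<G>"
proof -
  let ?islands = "\<lambda>t \<epsilon> G. \<exists>\<I>. (\<forall>S\<in>\<I>. is_island t G S) \<and> pairwise disjnt \<I> \<and>
    real (card \<I>) \<ge> \<epsilon> * real (card (pverts G))"
  \<comment> \<open>For each \<open>t\<close> the two conditions are equivalent, with different
    \<open>\<epsilon>\<close>, so both infima are taken over the same set, even when it is
    empty.\<close>
  have "(\<exists>\<epsilon>>0. \<forall>G\<in>\<G>. ?islands t \<epsilon> G) \<longleftrightarrow>
      (\<exists>\<epsilon>>0. \<forall>G\<in>\<G>. pverts G \<noteq> {} \<longrightarrow> resistant \<epsilon> t G)" for t
  proof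
    assume "\<exists>\<epsilon>>0. \<forall>G\<in>\<G>. ?islands t \<epsilon> G"
    then obtain \<epsilon> where \<epsilon>: "\<epsilon> > 0" "\<And>G. G \<in> \<G> \<Longrightarrow> ?islands t \<epsilon> G" by blast
    have "resistant (\<epsilon> / 2) t G" if G: "G \<in> \<G>" "pverts G \<noteq> {}" for G
    proof -
      interpret pair_graph G using assms(1)[OF G(1)] .
      show ?thesis using \<epsilon>(2)[OF G(1)] resistant_if_islands[OF pair_finite_verts G(2) \<epsilon>(1)] by blast
    qed
    then show "\<exists>\<epsilon>>0. \<forall>G\<in>\<G>. pverts G \<noteq> {} \<longrightarrow> resistant \<epsilon> t G"
      using \<epsilon>(1) by (intro exI[of _ "\<epsilon> / 2"]) auto
  next
    assume "\<exists>\<epsilon>>0. \<forall>G\<in>\<G>. pverts G \<noteq> {} \<longrightarrow> resistant \<epsilon> t G"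
    then obtain \<epsilon> where \<epsilon>: "\<epsilon> > 0" and res: "\<And>G. G \<in> \<G> \<Longrightarrow> pverts G \<noteq> {} \<Longrightarrow> resistant \<epsilon> t G"
      by blast
    obtain M where M: "M \<ge> 1" and frag: "\<And>(V :: 'a set) E. sym E \<Longrightarrow> finite V \<Longrightarrow>
        (\<forall>\<C>. clique_model E \<C> \<longrightarrow> \<Union>\<C> \<subseteq> V \<longrightarrow> finite \<C> \<longrightarrow> card \<C> \<noteq> card (pverts H)) \<Longrightarrow>
        (\<exists>X\<subseteq>V. real (card X) \<le> \<epsilon> / 2 * real (card V) \<and>
          (\<forall>U\<subseteq>V - X. linked E U \<longrightarrow> card U \<le> M))"
      using fragmentation[of "\<epsilon> / 2" "card (pverts H)"] \<epsilon> by auto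
    have "?islands t (\<epsilon> / (2 * real M)) G" if G: "G \<in> \<G>" for G
    proof (cases "pverts G = {}")
      \<comment> \<open>Resistance is assumed only for graphs with a vertex; for the null graph the
        empty family of islands suffices.\<close>
      case True
      then show ?thesis by (intro exI[of _ "{}"]) auto
    next
      case False
      interpret pair_graph G using assms(1)[OF G] .
      have "sym (parcs G)" using arcs_symmetric by (auto intro: symI)
      moreover have "card \<C> \<noteq> card (pverts H)"
        if "clique_model (parcs G) \<C>" "\<Union>\<C> \<subseteq> pverts G" "finite \<C>" for \<C>
        using is_minor_if_clique_model[OF assms(3) that] assms(4)[OF G] unfolding minor_free_def by blast
      ultimately obtain X where X: "X \<subseteq> pverts G" "real (card X) \<le> \<epsilon> / 2 * real (card (pverts G))"
          "\<And>U. U \<subseteq> pverts G - X \<Longrightarrow> linked (parcs G) U \<Longrightarrow> card U \<le> M"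
        using frag[of "parcs G" "pverts G"] pair_finite_verts by blast
      show ?thesis using islands_if_resistant[OF assms(1)[OF G] M \<epsilon> X res[OF G False]] .
    qed
    then show "\<exists>\<epsilon>>0. \<forall>G\<in>\<G>. ?islands t \<epsilon> G"
      using \<epsilon> M by (intro exI[of _ "\<epsilon> / (2 * real M)"]) auto
  qed
  then show ?thesis unfolding pcol_star_def percolation_threshold_def by simp
qed

end
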